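(* Let $c\in[0,1)$ and $0<W_{\min}\le W_{\max}$. Consider all weighted COA consistency instances, i.e. weighted instances $P$ (any $n$) such that every agent is either located at $(0,1)$ with weight $W_{\max}$ or located at $(x,0)$ or $(-x,0)$ with weight $W_{\min}$ for some common $x\ge 0$, $(0,1)$ is an optimal location $o(P)$, and CMP with the accurate prediction $\hat o=o(P)=(0,1)$ outputs $f(P,(0,1),c)=(0,0)$. The worst case (supremum) over all such instances of the approximation ratio $C^u(f(P,o(P),c),P)/C^u(o(P),P)$ equals $$\frac{\sqrt{(1+c)^2W_{\min}^2+(1-c)^2W_{\max}^2}}{(1+c)W_{\min}}.$$
   Context: Weighted instance: a multiset $P=\{p_1,\dots,p_n\}\subset\mathbb{R}^2$ with weights $w_i>0$; $d$ is Euclidean distance; $C^u(f,P)=\frac1n\sum_i w_i d(f,p_i)$; $o(P)$ is a minimizer of $C^u(\cdot,P)$. The CMP mechanism with confidence $c\in[0,1)$ and prediction $\hat o\in\mathbb{R}^2$: let $m=\lfloor cn\rfloor$, let $P'$ be $P$ together with $m$ copies of $\hat o$, and output $f(P,\hat o,c)=(x_{\mathrm{med}},y_{\mathrm{med}})$, where $x_{\mathrm{med}}$ (resp. $y_{\mathrm{med}}$) is the median of the $x$-coordinates (resp. $y$-coordinates) of the $n+m$ points of $P'$, taking the smaller of the two middle values when $n+m$ is even. CMP does not use the weights.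
   Formalization: As stated (supremum over any n, with m=⌊cn⌋) the claim fails for every c in (0,1) by rounding; proved instead: for rational c, the supremum over instances with cn an integer equals the formula, and for every c in [0,1) the supremum over instances of size n tends to it as n→∞. *)

theory Defs
  imports "HOL-Analysis.Analysis"
begin

text \<open>The type \<^typ>\<open>real \<times> real\<close> carries the Euclidean metric.  A weighted instance is a
  multiset of (location, weight) pairs, so that agents may share a location and a weight.\<close>

type_synonym point = "real \<times> real"
type_synonym winstance = "(point \<times> real) multiset"

definition weighted_instance :: "winstance \<Rightarrow> bool" where
  "weighted_instance P \<longleftrightarrow> P \<noteq> {#} \<and> (\<forall>(p, w) \<in># P. w > 0)"

definition social_cost :: "point \<Rightarrow> winstance \<Rightarrow> real" where
  "social_cost f P = (\<Sum>(p, w) \<in># P. w * dist f p) / real (size P)"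

definition optimal_location :: "point \<Rightarrow> winstance \<Rightarrow> bool" where
  "optimal_location z P \<longleftrightarrow> (\<forall>g. social_cost z P \<le> social_cost g P)"

text \<open>With 0-based indices, position \<open>(N - 1) div 2\<close> is the middle one for odd \<open>N\<close> and the
  smaller of the two middle ones for even \<open>N\<close>.\<close>

definition lower_median :: "real multiset \<Rightarrow> real" where
  "lower_median M = sorted_list_of_multiset M ! ((size M - 1) div 2)"

definition cmp :: "winstance \<Rightarrow> point \<Rightarrow> real \<Rightarrow> point" where
  "cmp P z c =
     (let m = nat \<lfloor>c * real (size P)\<rfloor>;
          P' = image_mset fst P + replicate_mset m z
      in (lower_median (image_mset fst P'), lower_median (image_mset snd P')))"

definition coa_consistency_instance :: "real \<Rightarrow> real \<Rightarrow> real \<Rightarrow> winstance \<Rightarrow> bool" where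
  "coa_consistency_instance c Wmin Wmax P \<longleftrightarrow>
     weighted_instance P \<and>
     (\<exists>x\<ge>0. \<forall>(p, w) \<in># P.
        p = (0, 1) \<and> w = Wmax \<or> (p = (x, 0) \<or> p = (- x, 0)) \<and> w = Wmin) \<and>
     optimal_location (0, 1) P \<and>
     cmp P (0, 1) c = (0, 0)"

text \<open>Intended for optimal \<open>z\<close>.  On a COA consistency instance with positive weights the
  denominator is positive: if all agents were at \<open>(0, 1)\<close>, CMP would not output \<open>(0, 0)\<close>.\<close>

definition consistency_ratio :: "real \<Rightarrow> point \<Rightarrow> winstance \<Rightarrow> real" where
  "consistency_ratio c z P = social_cost (cmp P z c) P / social_cost z P"

text \<open>Suprema are taken in \<^typ>\<open>ereal\<close>, where the empty and the unbounded case have their proper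
  values \<open>-\<infinity>\<close> and \<open>\<infinity>\<close>.

  The two worst cases below differ in how they treat the rounding \<open>\<lfloor>c n\<rfloor>\<close> in \<^const>\<open>cmp\<close>.  A
  supremum over all \<open>n\<close> alike would be dominated by small \<open>n\<close> for which the effective confidence
  \<open>\<lfloor>c n\<rfloor> / n\<close> is below \<open>c\<close>; e.g. for \<open>0 < c < 1/2\<close> and \<open>n = 2\<close> no copy of the prediction is
  added at all, and agents at \<open>(0, 1)\<close> and \<open>(1, 0)\<close> of weight \<open>1\<close> have ratio \<open>sqrt 2\<close>, which is
  larger than \<open>sqrt ((1 + c)\<^sup>2 + (1 - c)\<^sup>2) / (1 + c)\<close>.\<close>

definition exact_worst_case :: "real \<Rightarrow> real \<Rightarrow> real \<Rightarrow> ereal" where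
  "exact_worst_case c Wmin Wmax =
     (SUP P \<in> {P. coa_consistency_instance c Wmin Wmax P \<and> c * real (size P) \<in> \<int>}.
        ereal (consistency_ratio c (0, 1) P))"

definition worst_case_of_size :: "real \<Rightarrow> real \<Rightarrow> real \<Rightarrow> nat \<Rightarrow> ereal" where
  "worst_case_of_size c Wmin Wmax n =
     (SUP P \<in> {P. coa_consistency_instance c Wmin Wmax P \<and> size P = n}.
        ereal (consistency_ratio c (0, 1) P))"

end

theory Submission
  imports Defs
begin

text \<open>Let \<open>a\<close> agents sit at \<open>(0, 1)\<close> and \<open>b\<close> at \<open>(\<plusminus>x, 0)\<close>, let \<open>m\<close> be the number of copies of the
  prediction, and put \<open>t = a Wmax / (b Wmin)\<close>.  The ratio is \<open>(t + x) / sqrt (1 + x\<^sup>2)\<close>, which by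
  Cauchy-Schwarz is at most \<open>sqrt (1 + t\<^sup>2)\<close>, with equality for \<open>x = 1 / t\<close>.  The median of the
  \<open>y\<close>-coordinates is \<open>0\<close> iff \<open>a + m \<le> b\<close>, so that \<open>a / b \<le> (n - m) / (n + m)\<close>, which is
  \<open>(1 - c) / (1 + c)\<close> up to rounding.  The extremal instances take the smallest
  such \<open>b\<close> up to rounding and split it evenly between both sides; they are optimal at \<open>(0, 1)\<close> by
  the supporting hyperplanes of the distance functions.\<close>

section \<open>Order statistics and the lower median\<close>

lemma sorted_nth_downward_closed_iff:
  fixes xs :: "'a :: linorder list"
  assumes "sorted xs" and "\<And>x y. x \<le> y \<Longrightarrow> P y \<Longrightarrow> P x" and "j < length xs"
  shows "P (xs ! j) \<longleftrightarrow> j < length (filter P xs)"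
  using assms(1,3)
proof (induction xs arbitrary: j)
  case (Cons x xs)
  show ?case
  proof (cases "P x")
    case True
    then show ?thesis
      using Cons by (cases j) auto
  next
    case False
    \<comment> \<open>Downward closure makes the elements satisfying \<open>P\<close> a prefix of a
      sorted list, so a failing head rules out every entry.\<close>
    have "\<not> P y" if "y \<in> set (x # xs)" for y
      using that False Cons.prems(1) assms(2) by auto
    then have "filter P (x # xs) = []" and "\<not> P ((x # xs) ! j)"
      using nth_mem[OF Cons.prems(2)] by (auto simp: filter_empty_conv simp del: nth_mem)
    then show ?thesis by (metis list.size(3) not_less_zero)
  qed
qed simp

text \<open>Turns statements about the median into counts; it is applied to the half-lines
  \<open>y \<le> v\<close> and \<open>y < v\<close>. Nonemptiness keeps the median index in
  range.\<close>

lemma lower_median_downward_closed_iff: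
  assumes "M \<noteq> {#}" and "\<And>x y. x \<le> y \<Longrightarrow> P y \<Longrightarrow> P x"
  shows "P (lower_median M) \<longleftrightarrow> (size M - 1) div 2 < size (filter_mset P M)"
proof -
  define xs where "xs = sorted_list_of_multiset M"
  have M: "mset xs = M" unfolding xs_def by simp
  have len: "length xs = size M" using M by (metis size_mset)
  have "P (xs ! ((size M - 1) div 2)) \<longleftrightarrow> (size M - 1) div 2 < length (filter P xs)"
  proof (rule sorted_nth_downward_closed_iff)
    show "sorted xs" unfolding xs_def by simp
    have "size M > 0" using assms(1) by (simp add: nonempty_has_size)
    then show "(size M - 1) div 2 < length xs" unfolding len by linarith
  qed (rule assms(2))
  moreover have "length (filter P xs) = size (filter_mset P M)"
    using M by (metis mset_filter size_mset)
  ultimately show ?thesis by (simp add: lower_median_def xs_def)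
qed

text \<open>The two counts say that the median is not below \<open>v\<close> and is at most
  \<open>v\<close>.\<close>

lemma lower_median_eqI:
  assumes "size (filter_mset (\<lambda>y. y < v) M) \<le> (size M - 1) div 2"
    and "(size M - 1) div 2 < size (filter_mset (\<lambda>y. y \<le> v) M)"
  shows "lower_median M = v"
proof -
  have ne: "M \<noteq> {#}" using assms(2) by auto
  show ?thesis
    using lower_median_downward_closed_iff[of M "\<lambda>y. y \<le> v"]
      lower_median_downward_closed_iff[of M "\<lambda>y. y < v"] ne assms by force
qed

lemma filter_mset_replicate_mset:
  "filter_mset P (replicate_mset n x) = (if P x then replicate_mset n x else {#})"
  by (induction n) auto

section \<open>Upper bound for a single instance\<close>

lemma sum_mset_image_const:
  fixes k :: real
  assumes "\<And>e. e \<in># M \<Longrightarrow> g e = k"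
  shows "(\<Sum>e\<in>#M. g e) = real (size M) * k"
proof -
  have "image_mset g M = image_mset (\<lambda>_. k) M"
    by (rule image_mset_cong) (rule assms)
  then show ?thesis by (simp add: sum_mset_constant)
qed

lemma add_le_sqrt_mult_sqrt:
  fixes t x :: real
  shows "t + x \<le> sqrt (1 + t\<^sup>2) * sqrt (1 + x\<^sup>2)"
  using norm_cauchy_schwarz[of "(1, t)" "(x, 1)"]
  by (simp add: norm_Pair add.commute)

text \<open>The rounded count \<open>m\<close> stays in the bound, so that the integral case and the
  limit can both be read off from it.\<close>

lemma coa_ratio_le:
  fixes c Wmin Wmax :: real
  assumes "0 < Wmin" and "0 < Wmax" and coa: "coa_consistency_instance c Wmin Wmax P"
  defines "n \<equiv> real (size P)"
  defines "m \<equiv> real (nat \<lfloor>c * n\<rfloor>)"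
  shows "consistency_ratio c (0, 1) P \<le> sqrt (1 + (Wmax / Wmin * ((n - m) / (n + m)))\<^sup>2)"
proof -
  obtain x where "x \<ge> 0" and
    P: "\<And>p w. (p, w) \<in># P \<Longrightarrow> p = (0, 1) \<and> w = Wmax \<or> (p = (x, 0) \<or> p = (- x, 0)) \<and> w = Wmin"
    and ne: "P \<noteq> {#}" and out: "cmp P (0, 1) c = (0, 0)"
    using coa unfolding coa_consistency_instance_def weighted_instance_def by fastforce
  define top where "top = (\<lambda>e :: point \<times> real. fst e = (0, 1))"
  define A where "A = filter_mset top P"
  define L where "L = filter_mset (\<lambda>e. \<not> top e) P"
  define a where "a = real (size A)"
  define b where "b = real (size L)"
  have PAL: "P = A + L" unfolding A_def L_def by simp
  have n: "n = a + b" unfolding n_def a_def b_def PAL by simp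
  have A: "e = ((0, 1), Wmax)" if "e \<in># A" for e
    using that P[of "fst e" "snd e"] unfolding A_def top_def by (cases e) auto
  have L: "(e = ((x, 0), Wmin) \<or> e = ((- x, 0), Wmin))" if "e \<in># L" for e
    using that P[of "fst e" "snd e"] unfolding L_def top_def by (cases e) auto

  define ys where "ys = image_mset (\<lambda>e. snd (fst e)) P + replicate_mset (nat \<lfloor>c * n\<rfloor>) 1"
  have size_ys: "real (size ys) = n + m" unfolding ys_def n_def m_def by simp
  have "lower_median ys = 0"
    using out unfolding cmp_def ys_def n_def
    by (simp add: Let_def image_mset.compositionality o_def)
  moreover have "ys \<noteq> {#}" using ne unfolding ys_def by simp
  ultimately have "(size ys - 1) div 2 < size (filter_mset (\<lambda>y. y \<le> 0) ys)"
    using lower_median_downward_closed_iff[of ys "\<lambda>y. y \<le> 0"] by simp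
  \<comment> \<open>Agents in \<open>A\<close> and copies of the prediction all have height 1, so
    only \<open>L\<close> contributes.\<close>
  also have "filter_mset (\<lambda>y. y \<le> 0) ys = filter_mset (\<lambda>y. y \<le> 0) (image_mset (\<lambda>e. snd (fst e)) L)"
  proof -
    have "filter_mset (\<lambda>y. y \<le> 0) (image_mset (\<lambda>e. snd (fst e)) A) = {#}"
      by (auto dest!: A)
    then show ?thesis unfolding ys_def PAL by (simp add: filter_mset_replicate_mset)
  qed
  also have "size \<dots> \<le> size L" by (metis size_filter_mset_lesseq size_image_mset)
  \<comment> \<open>For positive N, \<open>(N - 1) div 2 < k\<close> amounts to
    \<open>N \<le> 2 * k\<close>: by the choice of the smaller middle value, a tie goes to height
    0.\<close>
  finally have "size ys \<le> 2 * size L" by linarith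
  then have b_ge: "n + m \<le> 2 * b"
    unfolding b_def size_ys[symmetric] by linarith
  have n_pos: "n > 0" unfolding n_def using ne by (simp add: nonempty_has_size)
  have m_nn: "m \<ge> 0" unfolding m_def by simp
  have b_pos: "b > 0" using b_ge n_pos m_nn by linarith

  have cost0: "social_cost (0, 0) P = (Wmax * a + Wmin * b * x) / n"
  proof -
    have "(\<Sum>(p, w)\<in>#A. w * dist (0, 0) p) = a * Wmax" unfolding a_def
      by (rule sum_mset_image_const) (auto dest!: A simp: dist_Pair_Pair)
    moreover have "(\<Sum>(p, w)\<in>#L. w * dist (0, 0) p) = b * (Wmin * x)" unfolding b_def
      by (rule sum_mset_image_const) (use \<open>x \<ge> 0\<close> in \<open>auto dest!: L simp: dist_Pair_Pair\<close>)
    ultimately show ?thesis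
      unfolding social_cost_def n_def PAL by (simp add: algebra_simps)
  qed
  have cost1: "social_cost (0, 1) P = Wmin * b * sqrt (1 + x\<^sup>2) / n"
  proof -
    have "(\<Sum>(p, w)\<in>#A. w * dist (0, 1) p) = a * 0" unfolding a_def
      by (rule sum_mset_image_const) (auto dest!: A)
    moreover have "(\<Sum>(p, w)\<in>#L. w * dist (0, 1) p) = b * (Wmin * sqrt (1 + x\<^sup>2))" unfolding b_def
      by (rule sum_mset_image_const)
        (auto dest!: L simp: dist_Pair_Pair dist_real_def add.commute)
    ultimately show ?thesis
      unfolding social_cost_def n_def PAL by (simp add: algebra_simps)
  qed
  define t where "t = Wmax * a / (Wmin * b)"
  have s_pos: "sqrt (1 + x\<^sup>2) > 0" by (simp add: add_pos_nonneg)
  have "consistency_ratio c (0, 1) P = (Wmax * a + Wmin * b * x) / (Wmin * b * sqrt (1 + x\<^sup>2))"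
    unfolding consistency_ratio_def out cost0 cost1 using n_pos by simp
  also have "\<dots> = (t + x) / sqrt (1 + x\<^sup>2)"
    unfolding t_def using b_pos \<open>0 < Wmin\<close> s_pos by (simp add: field_simps)
  also have "\<dots> \<le> sqrt (1 + t\<^sup>2)"
    using add_le_sqrt_mult_sqrt[of t x] s_pos by (simp add: pos_divide_le_eq)
  also have "\<dots> \<le> sqrt (1 + (Wmax / Wmin * ((n - m) / (n + m)))\<^sup>2)"
  proof -
    \<comment> \<open>Combines \<open>n + m \<le> 2 * b\<close> with its consequence
      \<open>2 * a \<le> n - m\<close>, which follows from \<open>n = a + b\<close>.\<close>
    have "a * (n + m) \<le> (n - m) * b"
    proof -
      have "a * (n + m) \<le> a * (2 * b)"
        using b_ge by (intro mult_left_mono) (simp_all add: a_def)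
      also have "\<dots> = (2 * a) * b" by simp
      also have "\<dots> \<le> (n - m) * b"
        using b_ge n b_pos by (intro mult_right_mono) linarith+
      finally show ?thesis .
    qed
    then have "a / b \<le> (n - m) / (n + m)"
      using b_pos n_pos m_nn by (simp add: divide_simps)
    then have "Wmax / Wmin * (a / b) \<le> Wmax / Wmin * ((n - m) / (n + m))"
      using assms(1,2) by (intro mult_left_mono) simp_all
    then have "t \<le> Wmax / Wmin * ((n - m) / (n + m))"
      unfolding t_def by simp
    moreover have "t \<ge> 0" unfolding t_def a_def using b_pos assms(1,2) by simp
    ultimately show ?thesis by (simp add: power_mono)
  qed
  finally show ?thesis .
qed

section \<open>Instances attaining the bound\<close>

lemma supporting_line_dist:
  fixes x y u v :: real
  assumes "s = sqrt (1 + x\<^sup>2)"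
  shows "s + (v - 1 - x * u) / s \<le> dist (u, v) (x, 0)"
proof -
  have s: "s > 0" "s\<^sup>2 = 1 + x\<^sup>2" using assms by (simp_all add: add_pos_nonneg)
  \<comment> \<open>The left side of the claim is the tangent at (0, 1) of the distance to (x, 0),
    with gradient (-x, 1) / s. Cauchy-Schwarz against this direction gives the convexity
    inequality.\<close>
  have "(u - x) * (- x) + v * 1 \<le> norm (u - x, v) * norm (- x, 1 :: real)"
    using norm_cauchy_schwarz[of "(u - x, v)" "(- x, 1)"] by simp
  also have "norm (- x, 1 :: real) = s" using assms by (simp add: norm_Pair add.commute)
  also have "norm (u - x, v) = dist (u, v) (x, 0)" by (simp add: dist_norm)
  finally have "s\<^sup>2 + (v - 1 - x * u) \<le> dist (u, v) (x, 0) * s"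
    unfolding s(2) by (simp add: algebra_simps power2_eq_square)
  then show ?thesis using s(1) by (simp add: field_simps power2_eq_square)
qed

text \<open>\<open>am\<close> says that the 2 h agents at height 0 make up at least half of the
  points seen by the mechanism. Splitting them evenly centres the x-median and balances the
  horizontal pulls at (0, 1).\<close>

lemma coa_instance_attaining:
  fixes c Wmin Wmax :: real and a h :: nat
  assumes "0 < Wmin" and "0 < Wmax" and "0 < a"
    and am: "a + nat \<lfloor>c * real (a + 2 * h)\<rfloor> \<le> 2 * h"
  obtains P where "coa_consistency_instance c Wmin Wmax P" and "size P = a + 2 * h"
    and "consistency_ratio c (0, 1) P = sqrt (1 + (Wmax / Wmin * (real a / (2 * real h)))\<^sup>2)"
proof -
  \<comment> \<open>This is 1 / t, the equality case of Cauchy-Schwarz. It also gives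
    \<open>Wmax * a * x = 2 * Wmin * h\<close>, which drives the optimality proof.\<close>
  define x where "x = 2 * Wmin * real h / (Wmax * real a)"
  define s where "s = sqrt (1 + x\<^sup>2)"
  define P :: winstance where "P = replicate_mset a ((0, 1), Wmax)
    + replicate_mset h ((x, 0), Wmin) + replicate_mset h ((- x, 0), Wmin)"
  define m where "m = nat \<lfloor>c * real (a + 2 * h)\<rfloor>"
  have h: "h > 0" using am \<open>0 < a\<close> by simp
  have x: "x > 0" unfolding x_def using assms h by simp
  have s: "s > 0" "s\<^sup>2 = 1 + x\<^sup>2" unfolding s_def by (simp_all add: add_pos_nonneg)
  have xs: "x \<le> s" unfolding s_def by (rule real_le_rsqrt) simp
  have size_P: "size P = a + 2 * h" unfolding P_def by simp
  have cost: "social_cost g P = (Wmax * a * dist g (0, 1)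
      + Wmin * h * (dist g (x, 0) + dist g (- x, 0))) / size P" for g
    unfolding social_cost_def P_def by (simp add: algebra_simps)

  \<comment> \<open>There are h entries on each side of 0, and \<open>0 < a\<close> ensures at least
    one entry at 0, so the middle index falls among the zeros.\<close>
  have med_x: "lower_median (image_mset (fst \<circ> fst) P + replicate_mset m 0) = 0"
    by (rule lower_median_eqI) (use x am[folded m_def] h \<open>0 < a\<close> in \<open>simp_all add: P_def filter_mset_replicate_mset\<close>)
  have med_y: "lower_median (image_mset (snd \<circ> fst) P + replicate_mset m 1) = 0"
    by (rule lower_median_eqI) (use x am[folded m_def] h \<open>0 < a\<close> in \<open>simp_all add: P_def filter_mset_replicate_mset\<close>)
  have out: "cmp P (0, 1) c = (0, 0)"
    using med_x med_y unfolding cmp_def m_def size_P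
    by (simp add: Let_def image_mset.compositionality o_def)

  have cost1: "social_cost (0, 1) P = 2 * Wmin * h * s / size P"
    unfolding cost s_def by (simp add: dist_Pair_Pair dist_real_def add.commute)
  have cost0: "social_cost (0, 0) P = (Wmax * a + 2 * Wmin * h * x) / size P"
    unfolding cost using x by (simp add: dist_Pair_Pair dist_real_def)

  have opt: "optimal_location (0, 1) P"
    unfolding optimal_location_def
  proof
    fix g :: point
    obtain u v where g: "g = (u, v)" by (cases g)
    \<comment> \<open>Adding the tangents for x and -x cancels the terms in u, leaving a bound in
      the height v alone.\<close>
    have "2 * (s + (v - 1) / s) \<le> dist g (x, 0) + dist g (- x, 0)"
    proof -
      have "2 * (s + (v - 1) / s) = (s + (v - 1 - x * u) / s) + (s + (v - 1 - (- x) * u) / s)"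
        by (simp add: add_divide_distrib diff_divide_distrib)
      also have "\<dots> \<le> dist g (x, 0) + dist g (- x, 0)"
        unfolding g by (intro add_mono supporting_line_dist) (simp_all add: s_def)
      finally show ?thesis .
    qed
    then have "Wmin * h * (2 * (s + (v - 1) / s)) \<le> Wmin * h * (dist g (x, 0) + dist g (- x, 0))"
      using \<open>0 < Wmin\<close> by (intro mult_left_mono) simp_all
    \<comment> \<open>Moving down from (0, 1) gains at rate at most
      \<open>2 * Wmin * h / s = Wmax * a * x / s\<close>. Since \<open>x \<le> s\<close>, the agents
      at (0, 1) outweigh this gain.\<close>
    moreover have "2 * Wmin * h * ((1 - v) / s) \<le> Wmax * a * dist g (0, 1)"
    proof -
      have "2 * Wmin * h = Wmax * a * x" unfolding x_def using assms by simp
      then have "2 * Wmin * h * ((1 - v) / s) = Wmax * a * (x / s * (1 - v))" by simp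
      also have "x / s * (1 - v) \<le> x / s * \<bar>1 - v\<bar>"
        using x s by (intro mult_left_mono) auto
      also have "\<dots> \<le> 1 * \<bar>1 - v\<bar>"
        using xs s by (intro mult_right_mono) auto
      also have "1 * \<bar>1 - v\<bar> \<le> dist g (0, 1)"
        using dist_snd_le[of g "(0, 1)"] unfolding g by (simp add: dist_real_def)
      finally show ?thesis using assms by (simp add: mult_left_mono)
    qed
    ultimately have "2 * Wmin * h * s \<le> Wmax * a * dist g (0, 1)
      + Wmin * h * (dist g (x, 0) + dist g (- x, 0))"
      using s(1) by (simp add: algebra_simps diff_divide_distrib)
    then show "social_cost (0, 1) P \<le> social_cost g P"
      unfolding cost1 cost[of g] by (rule divide_right_mono) simp
  qed

  show thesis
  proof
    have "weighted_instance P"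
      unfolding weighted_instance_def P_def using assms by (auto split: if_splits)
    moreover have "\<forall>(p, w) \<in># P.
        p = (0, 1) \<and> w = Wmax \<or> (p = (x, 0) \<or> p = (- x, 0)) \<and> w = Wmin"
      unfolding P_def by (auto split: if_splits)
    ultimately show "coa_consistency_instance c Wmin Wmax P"
      unfolding coa_consistency_instance_def using opt out less_imp_le[OF x] by blast
    show "size P = a + 2 * h" by (rule size_P)
    have t: "Wmax / Wmin * (real a / (2 * real h)) = 1 / x" unfolding x_def by simp
    have "consistency_ratio c (0, 1) P
        = (Wmax * a + 2 * Wmin * h * x) / (2 * Wmin * h * s)"
      unfolding consistency_ratio_def out cost0 cost1 using h size_P by simp
    also have "Wmax * a = 2 * Wmin * h * (1 / x)" unfolding x_def using assms h by simp
    also have "(2 * Wmin * h * (1 / x) + 2 * Wmin * h * x) / (2 * Wmin * h * s) = (1 / x + x) / s"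
      using assms h s by (simp add: field_simps)
    also have "\<dots> = (1 + x\<^sup>2) / (x * s)"
      using x by (simp add: field_simps power2_eq_square)
    also have "\<dots> = s / x"
      unfolding s(2)[symmetric] using s(1) by (simp add: power2_eq_square)
    also have "\<dots> = sqrt ((1 + x\<^sup>2) / x\<^sup>2)"
      unfolding s_def using x by (simp add: real_sqrt_divide)
    also have "(1 + x\<^sup>2) / x\<^sup>2 = 1 + (1 / x)\<^sup>2"
      using x by (simp add: field_simps)
    finally show "consistency_ratio c (0, 1) P
        = sqrt (1 + (Wmax / Wmin * (real a / (2 * real h)))\<^sup>2)" unfolding t .
  qed
qed

section \<open>Rounding errors and the two worst cases\<close>

lemma tendsto_divide_of_nat_of_bounded_diff:
  fixes f :: "nat \<Rightarrow> real"
  assumes "\<And>n. \<bar>f n - L * real n\<bar> \<le> C"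
  shows "(\<lambda>n. f n / real n) \<longlonglongrightarrow> L"
proof (rule LIM_zero_cancel, rule Lim_null_comparison)
  show "\<forall>\<^sub>F n in sequentially. norm (f n / real n - L) \<le> C / real n"
    using eventually_gt_at_top[of 0]
  proof eventually_elim
    case (elim n)
    then have "f n / real n - L = (f n - L * real n) / real n" by (simp add: field_simps)
    then show ?case using assms[of n] elim by (simp add: divide_right_mono)
  qed
  show "(\<lambda>n. C / real n) \<longlonglongrightarrow> 0" by (rule lim_const_over_n)
qed

theorem theorem4:
  fixes c Wmin Wmax :: real
  assumes "0 \<le> c" and "c < 1" and "0 < Wmin" and "Wmin \<le> Wmax"
  defines "B \<equiv> sqrt ((1 + c)\<^sup>2 * Wmin\<^sup>2 + (1 - c)\<^sup>2 * Wmax\<^sup>2) / ((1 + c) * Wmin)"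
  shows "(c \<in> \<rat> \<longrightarrow> exact_worst_case c Wmin Wmax = ereal B)
       \<and> worst_case_of_size c Wmin Wmax \<longlonglongrightarrow> ereal B"
proof -
  have Wmax: "0 < Wmax" using assms by linarith
  \<comment> \<open>Every bound is \<open>R\<close> of a headcount ratio a / b, so beyond the
    continuity of \<open>R\<close> only these ratios need to be followed.\<close>
  define R where "R = (\<lambda>t. sqrt (1 + (Wmax / Wmin * t)\<^sup>2))"
  have B: "B = R ((1 - c) / (1 + c))"
  proof -
    have "(1 + c)\<^sup>2 * Wmin\<^sup>2 + (1 - c)\<^sup>2 * Wmax\<^sup>2
        = ((1 + c) * Wmin)\<^sup>2 * (1 + (Wmax / Wmin * ((1 - c) / (1 + c)))\<^sup>2)"
    proof -
      have "((1 + c) * Wmin)\<^sup>2 * (Wmax / Wmin * ((1 - c) / (1 + c)))\<^sup>2 = ((1 - c) * Wmax)\<^sup>2"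
        unfolding power_mult_distrib[symmetric] using assms(1,3) by (simp add: mult.commute)
      then show ?thesis
        unfolding distrib_left mult_1_right by (simp only: power_mult_distrib)
    qed
    then show ?thesis unfolding B_def R_def using assms by (simp add: real_sqrt_mult)
  qed
  define m where "m = (\<lambda>n :: nat. nat \<lfloor>c * real n\<rfloor>)"
  \<comment> \<open>\<open>2 h\<close> agents at \<open>y = 0\<close> are at least half of the \<open>n + m\<close> points, so \<open>h\<close> is a quarter rounded up.\<close>
  define h where "h = (\<lambda>n. (n + m n + 3) div 4)"
  have upper: "consistency_ratio c (0, 1) P
      \<le> R ((real (size P) - m (size P)) / (real (size P) + m (size P)))"
    if "coa_consistency_instance c Wmin Wmax P" for P
    using coa_ratio_le[OF \<open>0 < Wmin\<close> Wmax that] unfolding R_def m_def .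
  \<comment> \<open>The guard \<open>2 * h n < n\<close> leaves at least one agent for (0, 1) and
    makes the natural subtraction \<open>n - 2 * h n\<close> exact.\<close>
  have lower: "\<exists>P. coa_consistency_instance c Wmin Wmax P \<and> size P = n
      \<and> consistency_ratio c (0, 1) P = R ((real n - 2 * h n) / (2 * real (h n)))"
    if "2 * h n < n" for n
  proof -
    have n: "(n - 2 * h n) + 2 * h n = n" using that by simp
    have m_n: "nat \<lfloor>c * real n\<rfloor> = m n" unfolding m_def by simp
    have "n + m n \<le> 4 * h n" unfolding h_def by linarith
    then have "(n - 2 * h n) + nat \<lfloor>c * real ((n - 2 * h n) + 2 * h n)\<rfloor> \<le> 2 * h n"
      unfolding n m_n using that by linarith
    moreover have "real (n - 2 * h n) = real n - 2 * h n" using that by simp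
    ultimately show ?thesis
      using coa_instance_attaining[OF \<open>0 < Wmin\<close> Wmax, of "n - 2 * h n" c "h n"] that
      unfolding n R_def by (metis zero_less_diff)
  qed

  have "exact_worst_case c Wmin Wmax = ereal B" if rat: "c \<in> \<rat>"
    unfolding exact_worst_case_def
  proof (rule antisym)
    show "(SUP P \<in> {P. coa_consistency_instance c Wmin Wmax P \<and> c * real (size P) \<in> \<int>}.
        ereal (consistency_ratio c (0, 1) P)) \<le> ereal B"
    proof (rule SUP_least, clarify)
      fix P assume P: "coa_consistency_instance c Wmin Wmax P" "c * real (size P) \<in> \<int>"
      then have "P \<noteq> {#}"
        unfolding coa_consistency_instance_def weighted_instance_def by blast
      \<comment> \<open>Integrality removes the floor, after which the size cancels from the
        ratio.\<close>
      have "real (m (size P)) = c * real (size P)"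
        unfolding m_def using P(2) \<open>0 \<le> c\<close> by (auto elim!: Ints_cases simp: zero_le_mult_iff)
      then have "(real (size P) - m (size P)) / (real (size P) + m (size P))
          = ((1 - c) * real (size P)) / ((1 + c) * real (size P))" by (simp add: algebra_simps)
      also have "\<dots> = (1 - c) / (1 + c)" using \<open>P \<noteq> {#}\<close> by simp
      finally show "ereal (consistency_ratio c (0, 1) P) \<le> ereal B"
        using upper[OF P(1)] unfolding B by simp
    qed
    obtain p q :: nat where "q \<noteq> 0" and "\<bar>c\<bar> = real p / real q"
      using rat by (rule Rats_abs_nat_div_natE)
    then have c: "c = real p / real q" using \<open>0 \<le> c\<close> by simp
    \<comment> \<open>Size 4 q makes both roundings exact: c n is the integer 4 p, and n + m = 4 (p
      + q) is divisible by 4. The supremum is therefore attained.\<close>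
    have cn: "c * real (4 * q) = real (4 * p)" using \<open>q \<noteq> 0\<close> c by simp
    have m: "m (4 * q) = 4 * p" unfolding m_def cn by (simp only: floor_of_nat nat_int)
    have h: "h (4 * q) = p + q" unfolding h_def m by simp
    have "p < q" using \<open>c < 1\<close> \<open>q \<noteq> 0\<close> unfolding c by (simp add: divide_simps)
    then obtain P where P: "coa_consistency_instance c Wmin Wmax P" "size P = 4 * q"
      "consistency_ratio c (0, 1) P = R ((real (4 * q) - 2 * (p + q)) / (2 * real (p + q)))"
      using lower[of "4 * q"] unfolding h by auto
    have "(real (4 * q) - 2 * (p + q)) / (2 * real (p + q)) = (1 - c) / (1 + c)"
    proof -
      have "1 - c = (real q - real p) / real q" "1 + c = (real q + real p) / real q"
        unfolding c using \<open>q \<noteq> 0\<close> by (simp_all add: diff_divide_distrib add_divide_distrib)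
      then have "(1 - c) / (1 + c) = (real q - real p) / (real q + real p)"
        using \<open>q \<noteq> 0\<close> by simp
      also have "\<dots> = (2 * (real q - real p)) / (2 * (real q + real p))"
        by (rule mult_divide_mult_cancel_left[symmetric]) simp
      finally show ?thesis by (simp add: algebra_simps)
    qed
    then have "consistency_ratio c (0, 1) P = B" using P(3) unfolding B by simp
    moreover have "c * real (size P) \<in> \<int>" unfolding P(2) cn by (rule Ints_of_nat)
    ultimately show "ereal B \<le> (SUP P \<in> {P. coa_consistency_instance c Wmin Wmax P
        \<and> c * real (size P) \<in> \<int>}. ereal (consistency_ratio c (0, 1) P))"
      using P(1) by (intro SUP_upper2[of P]) auto
  qed

  moreover have "worst_case_of_size c Wmin Wmax \<longlonglongrightarrow> ereal B"
  proof (rule tendsto_sandwich)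
    have m_diff: "\<bar>real (m n) - c * real n\<bar> \<le> 1" for n
      unfolding m_def using \<open>0 \<le> c\<close> by (simp add: of_nat_nat) linarith
    have m_lim: "(\<lambda>n. real (m n) / real n) \<longlonglongrightarrow> c"
      by (rule tendsto_divide_of_nat_of_bounded_diff) (rule m_diff)
    \<comment> \<open>Rounding up in \<open>h\<close> costs at most 3/4 and the floor in
      \<open>m\<close> at most 1/4, hence the error bound 1.\<close>
    have h_lim: "(\<lambda>n. real (h n) / real n) \<longlonglongrightarrow> (1 + c) / 4"
    proof (rule tendsto_divide_of_nat_of_bounded_diff)
      fix n
      define k where "k = c * real n"
      have "n + m n \<le> 4 * h n" "4 * h n \<le> n + m n + 3" unfolding h_def by linarith+
      then have "real n + m n \<le> 4 * real (h n)" "4 * real (h n) \<le> real n + m n + 3" by linarith+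
      moreover have "real (m n) \<le> k + 1" "k \<le> real (m n) + 1"
        using m_diff[of n] unfolding k_def by linarith+
      ultimately have "\<bar>real (h n) - (real n + k) / 4\<bar> \<le> 1"
        by (simp add: abs_le_iff field_simps)
      moreover have "(1 + c) / 4 * real n = (real n + k) / 4"
        unfolding k_def by (simp add: algebra_simps)
      ultimately show "\<bar>real (h n) - (1 + c) / 4 * real n\<bar> \<le> 1" by (simp only:)
    qed
    have R_lim: "(\<lambda>n. ereal (R (f n))) \<longlonglongrightarrow> ereal (R l)" if "f \<longlonglongrightarrow> l" for f l
      unfolding R_def by (intro tendsto_intros that)

    show "(\<lambda>n. ereal (R ((real n - 2 * h n) / (2 * real (h n))))) \<longlonglongrightarrow> ereal B"
      unfolding B
    proof (rule R_lim, rule Lim_transform_eventually)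
      have "(1 - 2 * ((1 + c) / 4)) / (2 * ((1 + c) / 4)) = (1 - c) / (1 + c)"
        using \<open>0 \<le> c\<close> by (simp add: divide_simps) (simp add: algebra_simps)
      moreover have "(\<lambda>n. (1 - 2 * (real (h n) / real n)) / (2 * (real (h n) / real n)))
          \<longlonglongrightarrow> (1 - 2 * ((1 + c) / 4)) / (2 * ((1 + c) / 4))"
        using \<open>0 \<le> c\<close> by (intro tendsto_intros h_lim) simp
      ultimately show "(\<lambda>n. (1 - 2 * (real (h n) / real n)) / (2 * (real (h n) / real n)))
          \<longlonglongrightarrow> (1 - c) / (1 + c)" by simp
      show "\<forall>\<^sub>F n in sequentially. (1 - 2 * (real (h n) / real n)) / (2 * (real (h n) / real n))
          = (real n - 2 * h n) / (2 * real (h n))"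
        using eventually_gt_at_top[of 0] by eventually_elim (simp add: divide_simps)
    qed
    show "(\<lambda>n. ereal (R ((real n - m n) / (real n + m n)))) \<longlonglongrightarrow> ereal B"
      unfolding B
    proof (rule R_lim, rule Lim_transform_eventually)
      show "(\<lambda>n. (1 - real (m n) / real n) / (1 + real (m n) / real n))
          \<longlonglongrightarrow> (1 - c) / (1 + c)"
        using \<open>0 \<le> c\<close> by (intro tendsto_intros m_lim) simp
      show "\<forall>\<^sub>F n in sequentially. (1 - real (m n) / real n) / (1 + real (m n) / real n)
          = (real n - m n) / (real n + m n)"
        using eventually_gt_at_top[of 0] by eventually_elim (simp add: divide_simps)
    qed
    \<comment> \<open>This holds for every n; if no instance has size n, the supremum is
      -\<infinity>.\<close>
    show "\<forall>\<^sub>F n in sequentially. worst_case_of_size c Wmin Wmax n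
        \<le> ereal (R ((real n - m n) / (real n + m n)))"
      unfolding worst_case_of_size_def using upper by (intro always_eventually allI SUP_least) auto
    \<comment> \<open>As c < 1, the limit (1 + c) / 4 is below 1/2, so the guard of
      \<open>lower\<close> eventually holds.\<close>
    have "\<forall>\<^sub>F n in sequentially. real (h n) / real n < 1 / 2"
      by (rule order_tendstoD(2)[OF h_lim]) (use \<open>c < 1\<close> in simp)
    then show "\<forall>\<^sub>F n in sequentially. ereal (R ((real n - 2 * h n) / (2 * real (h n))))
        \<le> worst_case_of_size c Wmin Wmax n"
      using eventually_gt_at_top[of 0]
    proof eventually_elim
      case (elim n)
      then have "2 * h n < n" by (simp add: divide_simps)
      then obtain P where "coa_consistency_instance c Wmin Wmax P" "size P = n"
        "consistency_ratio c (0, 1) P = R ((real n - 2 * h n) / (2 * real (h n)))"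
        using lower by blast
      then show ?case
        unfolding worst_case_of_size_def by (intro SUP_upper2[of P]) auto
    qed
  qed
  ultimately show ?thesis by blast
qed

end
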